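(* Let $G=(V,E)$ be a finite simple undirected graph and let $P=\{a_1,\dots,a_k\}\subseteq V$ be such that $G[P]$ is a path graph and $\deg(a)=2$ for all $a\in P$. Let $\Gamma(P)=\{a_0,a_{k+1}\}$ and $\Gamma(a_i)=\{a_{i-1},a_{i+1}\}$ for $i=1,\dots,k$. Then there exists a node ordering $\sigma'=x_1\cdots x_i\,a_1\cdots a_k\,x_{i+1}\cdots x_\ell$ of $G$, where $V\setminus P=\{x_1,\dots,x_\ell\}$, such that $\phi(G,\sigma')=\Phi(G)$.
   Context: $\Gamma(v)$ is the neighborhood of $v$; for $A\subseteq V$, $\Gamma(A)=\left(\bigcup_{x\in A}\Gamma(x)\right)\setminus A$. $G[P]$ is the subgraph induced by $P$. The deficiency of $x$ in $G$ is $D_G(x)=\{\{c,d\}: c,d\in\Gamma_G(x),\ c\neq d,\ \{c,d\}\notin E\}$. Eliminating $x$ gives $G_x=(V\setminus\{x\},\,E(V\setminus\{x\})\cup D_G(x))$, where $E(U)$ denotes the edges with both endpoints in $U$. A node ordering of $G$ with $n=|V|$ is a bijection $\sigma:\{1,\dots,n\}\to V$, written $x_1x_2\cdots x_n$ with $\sigma(j)=x_j$; it defines $G^{(0)}=G$, $G^{(i)}=(G^{(i-1)})_{\sigma(i)}$, and has fill-in $\phi(G,\sigma)=\sum_{i=1}^n|D_{G^{(i-1)}}(\sigma(i))|$. $\Phi(G)=\min_\sigma\phi(G,\sigma)$. *)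

theory Defs
  imports Main "HOL-Library.FuncSet"
begin

type_synonym 'a ugraph = "'a set \<times> 'a set set"

abbreviation verts :: "'a ugraph \<Rightarrow> 'a set" where
  "verts G \<equiv> fst G"

abbreviation edges :: "'a ugraph \<Rightarrow> 'a set set" where
  "edges G \<equiv> snd G"

definition finite_simple_graph :: "'a ugraph \<Rightarrow> bool" where
  "finite_simple_graph G \<longleftrightarrow>
     finite (verts G) \<and> (\<forall>e\<in>edges G. e \<subseteq> verts G \<and> card e = 2)"

definition nbhd :: "'a ugraph \<Rightarrow> 'a \<Rightarrow> 'a set" where
  "nbhd G v = {u. {u, v} \<in> edges G}"

definition nbhd_set :: "'a ugraph \<Rightarrow> 'a set \<Rightarrow> 'a set" where
  "nbhd_set G A = (\<Union>x\<in>A. nbhd G x) - A"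

definition degree :: "'a ugraph \<Rightarrow> 'a \<Rightarrow> nat" where
  "degree G v = card (nbhd G v)"

definition edges_within :: "'a ugraph \<Rightarrow> 'a set \<Rightarrow> 'a set set" where
  "edges_within G U = {e \<in> edges G. e \<subseteq> U}"

definition induced_subgraph :: "'a ugraph \<Rightarrow> 'a set \<Rightarrow> 'a ugraph" where
  "induced_subgraph G P = (P, edges_within G P)"

text \<open>A path graph has at least one vertex; a single vertex without edges counts as a path.\<close>

definition path_graph :: "'a ugraph \<Rightarrow> bool" where
  "path_graph H \<longleftrightarrow>
     (\<exists>m p. m \<ge> (1::nat) \<and> bij_betw p {1..m} (verts H) \<and>
            edges H = {{p j, p (j + 1)} | j. 1 \<le> j \<and> j < m})"

definition deficiency :: "'a ugraph \<Rightarrow> 'a \<Rightarrow> 'a set set" where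
  "deficiency G x =
     {{c, d} | c d. c \<in> nbhd G x \<and> d \<in> nbhd G x \<and> c \<noteq> d \<and> {c, d} \<notin> edges G}"

definition eliminate :: "'a ugraph \<Rightarrow> 'a \<Rightarrow> 'a ugraph" where
  "eliminate G x = (verts G - {x}, edges_within G (verts G - {x}) \<union> deficiency G x)"

text \<open>An ordering is a function on all of \<^typ>\<open>nat\<close>; its values outside \<open>{1..card (verts G)}\<close>
  are irrelevant.\<close>

definition node_ordering :: "'a ugraph \<Rightarrow> (nat \<Rightarrow> 'a) \<Rightarrow> bool" where
  "node_ordering G \<sigma> \<longleftrightarrow> bij_betw \<sigma> {1..card (verts G)} (verts G)"

primrec elim_graph :: "'a ugraph \<Rightarrow> (nat \<Rightarrow> 'a) \<Rightarrow> nat \<Rightarrow> 'a ugraph" where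
  "elim_graph G \<sigma> 0 = G"
| "elim_graph G \<sigma> (Suc i) = eliminate (elim_graph G \<sigma> i) (\<sigma> (Suc i))"

definition fill_in :: "'a ugraph \<Rightarrow> (nat \<Rightarrow> 'a) \<Rightarrow> nat" where
  "fill_in G \<sigma> = (\<Sum>i = 1..card (verts G). card (deficiency (elim_graph G \<sigma> (i - 1)) (\<sigma> i)))"

definition min_fill_in :: "'a ugraph \<Rightarrow> nat" where
  "min_fill_in G = Min {fill_in G \<sigma> | \<sigma>. node_ordering G \<sigma>}"

text \<open>The set under \<^const>\<open>Min\<close> is finite and nonempty, so the minimum is attained.\<close>

lemma elim_graph_cong:
  assumes "\<And>j. 1 \<le> j \<Longrightarrow> j \<le> i \<Longrightarrow> \<sigma> j = \<tau> j"
  shows "elim_graph G \<sigma> i = elim_graph G \<tau> i"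
  using assms by (induction i) auto

lemma fill_in_cong:
  assumes "\<And>j. j \<in> {1..card (verts G)} \<Longrightarrow> \<sigma> j = \<tau> j"
  shows "fill_in G \<sigma> = fill_in G \<tau>"
  unfolding fill_in_def
proof (rule sum.cong[OF refl])
  fix i assume i: "i \<in> {1..card (verts G)}"
  have "elim_graph G \<sigma> (i - 1) = elim_graph G \<tau> (i - 1)"
    using i by (intro elim_graph_cong assms) auto
  then show "card (deficiency (elim_graph G \<sigma> (i - 1)) (\<sigma> i)) =
             card (deficiency (elim_graph G \<tau> (i - 1)) (\<tau> i))"
    using assms[OF i] by simp
qed

lemma finite_fill_ins:
  assumes "finite (verts G)"
  shows "finite {fill_in G \<sigma> | \<sigma>. node_ordering G \<sigma>}"
proof (rule finite_subset)
  let ?I = "{1..card (verts G)}"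
  show "{fill_in G \<sigma> | \<sigma>. node_ordering G \<sigma>} \<subseteq> fill_in G ` (?I \<rightarrow>\<^sub>E verts G)"
  proof clarify
    fix \<sigma> assume "node_ordering G \<sigma>"
    then have "restrict \<sigma> ?I \<in> ?I \<rightarrow>\<^sub>E verts G"
      by (auto simp: node_ordering_def bij_betw_def)
    moreover have "fill_in G \<sigma> = fill_in G (restrict \<sigma> ?I)"
      by (rule fill_in_cong) simp
    ultimately show "fill_in G \<sigma> \<in> fill_in G ` (?I \<rightarrow>\<^sub>E verts G)" by blast
  qed
  show "finite (fill_in G ` (?I \<rightarrow>\<^sub>E verts G))"
    using assms by (intro finite_imageI finite_PiE) auto
qed

lemma min_fill_in_attained:
  assumes "finite (verts G)"
  shows "\<exists>\<sigma>. node_ordering G \<sigma> \<and> fill_in G \<sigma> = min_fill_in G"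
proof -
  obtain \<sigma> where "node_ordering G \<sigma>"
    using assms ex_bij_betw_nat_finite_1 unfolding node_ordering_def by blast
  then have "{fill_in G \<sigma> | \<sigma>. node_ordering G \<sigma>} \<noteq> {}" by blast
  from Min_in[OF finite_fill_ins[OF assms] this] show ?thesis
    unfolding min_fill_in_def by force
qed

lemma min_fill_in_le:
  assumes "finite (verts G)" and "node_ordering G \<sigma>"
  shows "min_fill_in G \<le> fill_in G \<sigma>"
  unfolding min_fill_in_def using assms by (intro Min_le finite_fill_ins) auto

end

theory Submission
  imports Defs
begin

text \<open>
  The minimum fill-in is the least number of edges whose addition makes \<open>G\<close> chordal, where
  chordal means having a perfect elimination ordering. Write \<open>u = a 0\<close> and \<open>w = a (k + 1)\<close>.

  If \<open>u\<close> and \<open>w\<close> are connected outside \<open>P\<close> (or equal), it is optimal to eliminate \<open>P\<close> first, one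
  vertex at a time: let \<open>v\<close> have the two neighbours \<open>u\<close> and \<open>b\<close> and let \<open>uv\<close> not be a bridge. In an
  optimal triangulation \<open>H\<close> the edge \<open>uv\<close> then lies in a triangle, so contracting it gives a chordal
  graph with at least two edges fewer. That graph contains \<open>G\<close> with \<open>v\<close> eliminated, which has just
  one edge less than \<open>G\<close> if \<open>ub\<close> is not an edge; so the fill-in drops by at least one.

  Otherwise let \<open>U\<close> be a set outside \<open>P\<close> that separates \<open>u\<close> from \<open>w\<close>. A chordal graph has a perfect
  elimination ordering ending in any prescribed vertex (Dirac), so an optimal triangulation
  restricted to \<open>U\<close> can be eliminated with \<open>u\<close> last; then \<open>a 1, \<dots>, a k\<close> have a single later
  neighbour each and cause no fill-in.
\<close>

section \<open>Graphs and elimination orderings as lists\<close>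

text \<open>Lists turn successive elimination into structural recursion;
  \<open>fill_in_eq_fill_list\<close> links this form to \<open>fill_in\<close>.\<close>

fun fill_list :: "'a ugraph \<Rightarrow> 'a list \<Rightarrow> nat" where
  "fill_list G [] = 0"
| "fill_list G (x # xs) = card (deficiency G x) + fill_list (eliminate G x) xs"

lemma fill_list_append:
  "fill_list G (xs @ ys) = fill_list G xs + fill_list (foldl eliminate G xs) ys"
  by (induction xs arbitrary: G) auto

lemma elim_graph_eq_foldl:
  "elim_graph G \<sigma> n = foldl eliminate G (map \<sigma> [1..<Suc n])"
  by (induction n) auto

lemma fill_in_eq_fill_list:
  "fill_in G \<sigma> = fill_list G (map \<sigma> [1..<Suc (card (verts G))])"
proof -
  have "(\<Sum>i = 1..n. card (deficiency (elim_graph G \<sigma> (i - 1)) (\<sigma> i))) =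
        fill_list G (map \<sigma> [1..<Suc n])" for n
    by (induction n) (auto simp: fill_list_append elim_graph_eq_foldl)
  then show ?thesis by (simp add: fill_in_def)
qed

definition list_ordering :: "'a ugraph \<Rightarrow> 'a list \<Rightarrow> bool" where
  "list_ordering G xs \<longleftrightarrow> distinct xs \<and> set xs = verts G"

lemma bij_betw_nth_pred:
  assumes "distinct xs"
  shows "bij_betw (\<lambda>j. xs ! (j - 1)) {1..length xs} (set xs)"
proof -
  have "bij_betw ((!) xs \<circ> (\<lambda>j. j - 1)) {1..length xs} (set xs)"
  proof (rule bij_betw_trans)
    show "bij_betw (\<lambda>j. j - 1) {1..length xs} {..<length xs}"
      by (rule bij_betw_byWitness[where f' = Suc]) auto
    show "bij_betw ((!) xs) {..<length xs} (set xs)"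
      using assms by (intro bij_betw_nth) auto
  qed
  then show ?thesis by (simp add: comp_def)
qed

lemma map_nth_pred: "map (\<lambda>j. xs ! (j - 1)) [1..<Suc (length xs)] = xs"
  by (rule nth_equalityI) (auto simp del: upt_Suc)

lemma list_ordering_node_ordering:
  assumes "list_ordering G xs"
  shows "node_ordering G (\<lambda>j. xs ! (j - 1))" "fill_in G (\<lambda>j. xs ! (j - 1)) = fill_list G xs"
proof -
  have n: "card (verts G) = length xs"
    using assms distinct_card unfolding list_ordering_def by metis
  show "node_ordering G (\<lambda>j. xs ! (j - 1))"
    using bij_betw_nth_pred[of xs] assms unfolding node_ordering_def n list_ordering_def by simp
  show "fill_in G (\<lambda>j. xs ! (j - 1)) = fill_list G xs"
    unfolding fill_in_eq_fill_list n map_nth_pred ..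
qed

lemma min_fill_in_le_fill_list:
  assumes "finite_simple_graph G" "list_ordering G xs"
  shows "min_fill_in G \<le> fill_list G xs"
  using min_fill_in_le[of G] list_ordering_node_ordering[OF assms(2)] assms(1)
  by (metis finite_simple_graph_def)

lemma min_fill_in_list_attained:
  assumes "finite_simple_graph G"
  obtains xs where "list_ordering G xs" "fill_list G xs = min_fill_in G"
proof -
  obtain \<sigma> where s: "node_ordering G \<sigma>" "fill_in G \<sigma> = min_fill_in G"
    using min_fill_in_attained assms by (metis finite_simple_graph_def)
  have "list_ordering G (map \<sigma> [1..<Suc (card (verts G))])"
    using s(1) unfolding list_ordering_def node_ordering_def bij_betw_def
    by (auto simp: distinct_map atLeastLessThanSuc_atLeastAtMost simp del: upt_Suc)
  then show thesis using that s(2) by (simp add: fill_in_eq_fill_list)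
qed

section \<open>Edge counts and how elimination changes them\<close>

lemma finite_edges: "finite_simple_graph G \<Longrightarrow> finite (edges G)"
  unfolding finite_simple_graph_def
  by (rule finite_subset[of _ "Pow (verts G)"]) auto

lemma edge_endpoints:
  assumes "finite_simple_graph G" "{x, y} \<in> edges G"
  shows "x \<in> verts G" "y \<in> verts G" "x \<noteq> y"
  using assms unfolding finite_simple_graph_def by (force simp: card_insert_if)+

lemma edge_cases:
  assumes "finite_simple_graph G" "e \<in> edges G"
  obtains x y where "e = {x, y}" "x \<noteq> y" "x \<in> verts G" "y \<in> verts G"
proof -
  have "card e = 2" "e \<subseteq> verts G" using assms unfolding finite_simple_graph_def by auto
  then show thesis using that by (auto simp: card_2_iff)
qed

lemma finite_nbhd: "finite_simple_graph G \<Longrightarrow> finite (nbhd G v)"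
  by (rule finite_subset[of _ "verts G"])
    (auto simp: nbhd_def finite_simple_graph_def)

lemma card_incident_edges:
  assumes "finite_simple_graph G"
  shows "card {e \<in> edges G. v \<in> e} = card (nbhd G v)"
proof -
  have "{e \<in> edges G. v \<in> e} = (\<lambda>x. {x, v}) ` nbhd G v"
  proof (intro equalityI subsetI)
    fix e assume e: "e \<in> {e \<in> edges G. v \<in> e}"
    then obtain x y where "e = {x, y}" using edge_cases[OF assms] by blast
    then show "e \<in> (\<lambda>x. {x, v}) ` nbhd G v"
      using e by (auto simp: nbhd_def insert_commute)
  qed (auto simp: nbhd_def)
  moreover have "inj_on (\<lambda>x. {x, v}) (nbhd G v)"
    by (auto simp: inj_on_def doubleton_eq_iff)
  ultimately show ?thesis by (simp add: card_image)
qed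

lemma card_edges_split:
  assumes "finite_simple_graph G"
  shows "card (edges G) = card {e \<in> edges G. v \<notin> e} + card (nbhd G v)"
proof -
  have "edges G = {e \<in> edges G. v \<notin> e} \<union> {e \<in> edges G. v \<in> e}" by auto
  then have "card (edges G) = card {e \<in> edges G. v \<notin> e} + card {e \<in> edges G. v \<in> e}"
    using finite_edges[OF assms]
    by (metis (no_types, lifting) card_Un_disjoint disjoint_iff finite_Un mem_Collect_eq)
  then show ?thesis by (simp add: card_incident_edges[OF assms])
qed

lemma edges_eliminate:
  assumes "finite_simple_graph G"
  shows "edges (eliminate G x) = {e \<in> edges G. x \<notin> e} \<union> deficiency G x"
  using assms unfolding eliminate_def edges_within_def finite_simple_graph_def by auto

lemma verts_eliminate [simp]: "verts (eliminate G x) = verts G - {x}"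
  by (simp add: eliminate_def)

lemma finite_simple_graph_eliminate:
  assumes "finite_simple_graph G"
  shows "finite_simple_graph (eliminate G x)"
  using assms edge_endpoints[OF assms]
  unfolding finite_simple_graph_def edges_eliminate[OF assms]
  by (auto simp: deficiency_def nbhd_def card_insert_if)

lemma finite_deficiency: "finite_simple_graph G \<Longrightarrow> finite (deficiency G x)"
  using finite_edges[OF finite_simple_graph_eliminate] edges_eliminate by (metis finite_Un)

text \<open>Elimination loses the edges at \<open>x\<close> and gains the deficiency; the additive
  form avoids subtraction on naturals.\<close>

lemma card_edges_eliminate:
  assumes "finite_simple_graph G"
  shows "card (edges (eliminate G x)) + card (nbhd G x) = card (edges G) + card (deficiency G x)"
proof -
  have "card (edges (eliminate G x)) = card {e \<in> edges G. x \<notin> e} + card (deficiency G x)"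
    unfolding edges_eliminate[OF assms] using finite_edges[OF assms] finite_deficiency[OF assms]
    by (intro card_Un_disjoint) (auto simp: deficiency_def)
  then show ?thesis using card_edges_split[OF assms, of x] by simp
qed

section \<open>Perfect elimination orderings and triangulations\<close>

text \<open>The later neighbours of each entry form a clique. \<open>E\<close> may contain edges
  outside the list, so one \<open>E\<close> serves all sublists, as in
  \<open>peo_filter\<close>.\<close>

fun peo :: "'a set set \<Rightarrow> 'a list \<Rightarrow> bool" where
  "peo E [] \<longleftrightarrow> True"
| "peo E (x # xs) \<longleftrightarrow>
     (\<forall>c\<in>set xs. \<forall>d\<in>set xs. {c, x} \<in> E \<longrightarrow> {d, x} \<in> E \<longrightarrow> c \<noteq> d \<longrightarrow> {c, d} \<in> E) \<and> peo E xs"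

lemma peo_cong:
  assumes "\<And>c d. c \<in> set xs \<Longrightarrow> d \<in> set xs \<Longrightarrow> c \<noteq> d \<Longrightarrow> {c, d} \<in> E \<longleftrightarrow> {c, d} \<in> E'"
    and "distinct xs" "peo E xs"
  shows "peo E' xs"
  using assms
proof (induction xs)
  case (Cons x xs)
  have iff: "{c, x} \<in> E \<longleftrightarrow> {c, x} \<in> E'" if "c \<in> set xs" for c
    using Cons.prems(1)[of c x] Cons.prems(2) that by auto
  have "peo E' xs" using Cons by simp
  then show ?case using Cons.prems iff by simp
qed simp

lemma peo_filter: "peo E xs \<Longrightarrow> peo E (filter Q xs)"
  by (induction xs) simp_all

text \<open>\<open>H\<close> is \<open>G\<close> with all fill edges added. Recursively, the edges
  of \<open>G\<close> at \<open>x\<close> are put back into a triangulation of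
  \<open>eliminate G x\<close>, where the neighbours of \<open>x\<close> have already become a
  clique.\<close>

lemma fill_list_triangulation:
  assumes "finite_simple_graph G" "list_ordering G xs"
  obtains H where "finite_simple_graph H" "verts H = verts G" "edges G \<subseteq> edges H"
    "peo (edges H) xs" "card (edges H) = card (edges G) + fill_list G xs"
  using assms
proof (induction xs arbitrary: G thesis)
  case Nil
  then show ?case by (metis add.right_neutral fill_list.simps(1) order_refl peo.simps(1))
next
  case (Cons x xs)
  note G = Cons.prems(2)
  let ?G = "eliminate G x" and ?I = "{e \<in> edges G. x \<in> e}"
  have xs: "x \<notin> set xs" "distinct xs" "set xs = verts G - {x}" "x \<in> verts G"
    using Cons.prems(3) by (auto simp: list_ordering_def)
  obtain K where K: "finite_simple_graph K" "verts K = verts ?G" "edges ?G \<subseteq> edges K"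
    "peo (edges K) xs" "card (edges K) = card (edges ?G) + fill_list ?G xs"
    using Cons.IH[OF _ finite_simple_graph_eliminate[OF G]] xs by (auto simp: list_ordering_def)
  have xK: "x \<notin> e" if "e \<in> edges K" for e
    using K(1,2) that unfolding finite_simple_graph_def by auto
  let ?H = "(verts G, edges K \<union> ?I)"
  have "finite_simple_graph ?H"
    using K(1,2) G unfolding finite_simple_graph_def by auto
  moreover have "edges G \<subseteq> edges ?H"
    using K(3) by (auto simp: edges_eliminate[OF G])
  moreover have "peo (edges ?H) (x # xs)"
  proof -
    have "peo (edges ?H) xs"
      using xs by (intro peo_cong[OF _ _ K(4)]) auto
    moreover have "{c, d} \<in> edges K" if "{c, x} \<in> edges ?H" "{d, x} \<in> edges ?H" "c \<noteq> d" for c d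
    proof -
      have c: "c \<in> nbhd G x" "d \<in> nbhd G x" using that xK by (auto simp: nbhd_def)
      then have "c \<noteq> x" "d \<noteq> x" using edge_endpoints[OF G] by (auto simp: nbhd_def)
      then have "{c, d} \<in> edges ?G"
        using c that(3) by (auto simp: edges_eliminate[OF G] deficiency_def)
      then show ?thesis using K(3) by auto
    qed
    ultimately show ?thesis by auto
  qed
  moreover have "card (edges ?H) = card (edges G) + fill_list G (x # xs)"
  proof -
    have "card (edges ?H) = card (edges K) + card ?I"
      using finite_edges[OF G] finite_edges[OF K(1)] xK by (auto intro!: card_Un_disjoint)
    then show ?thesis
      using K(5) card_edges_eliminate[OF G, of x] card_incident_edges[OF G, of x] by simp
  qed
  ultimately show ?case using Cons.prems(1)[of ?H] by simp
qed

text \<open>Since the neighbours of \<open>x\<close> in \<open>H\<close> form a clique,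
  \<open>H\<close> without \<open>x\<close> contains \<open>eliminate G x\<close>, so induction
  applies. The degree of \<open>x\<close> in \<open>H\<close> is at least that in \<open>G\<close>,
  which balances the edge counts.\<close>

lemma fill_list_le_triangulation:
  assumes "finite_simple_graph G" "list_ordering G xs"
    and "finite_simple_graph H" "verts H = verts G" "edges G \<subseteq> edges H" "peo (edges H) xs"
  shows "card (edges G) + fill_list G xs \<le> card (edges H)"
  using assms
proof (induction xs arbitrary: G H)
  case Nil
  then show ?case by (auto intro: card_mono finite_edges)
next
  case (Cons x xs)
  note G = Cons.prems(1) and H = Cons.prems(3)
  let ?G = "eliminate G x" and ?H = "(verts G - {x}, {e \<in> edges H. x \<notin> e})"
  have xs: "x \<notin> set xs" "distinct xs" "set xs = verts G - {x}" "x \<in> verts G"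
    using Cons.prems(2) by (auto simp: list_ordering_def)
  have "card (edges ?G) + fill_list ?G xs \<le> card (edges ?H)"
  proof (rule Cons.IH)
    show "finite_simple_graph ?G" using G by (rule finite_simple_graph_eliminate)
    show "list_ordering ?G xs" using xs by (simp add: list_ordering_def)
    show "finite_simple_graph ?H" using H Cons.prems(4) by (auto simp: finite_simple_graph_def)
    show "verts ?H = verts ?G" by simp
    have "deficiency G x \<subseteq> edges ?H"
    proof
      fix e assume "e \<in> deficiency G x"
      then obtain c d where e: "e = {c, d}" "{c, x} \<in> edges G" "{d, x} \<in> edges G" "c \<noteq> d"
        by (auto simp: deficiency_def nbhd_def)
      have "c \<in> set xs" "d \<in> set xs" "c \<noteq> x" "d \<noteq> x"
        using edge_endpoints[OF G e(2)] edge_endpoints[OF G e(3)] xs by auto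
      then show "e \<in> edges ?H" using e Cons.prems(5,6) by auto
    qed
    then show "edges ?G \<subseteq> edges ?H"
      using Cons.prems(5) unfolding edges_eliminate[OF G] by auto
    show "peo (edges ?H) xs"
    proof (rule peo_cong)
      show "peo (edges H) xs" using Cons.prems(6) by simp
      show "{c, d} \<in> edges H \<longleftrightarrow> {c, d} \<in> edges ?H" if "c \<in> set xs" "d \<in> set xs" for c d
        using that xs(1) by auto
    qed (rule xs(2))
  qed
  moreover have "card (nbhd G x) \<le> card (nbhd H x)"
    using Cons.prems(5) by (intro card_mono finite_nbhd[OF H]) (auto simp: nbhd_def)
  ultimately show ?case
    using card_edges_eliminate[OF G, of x] card_edges_split[OF H, of x] by simp
qed

section \<open>Simplicial vertices and the choice of the last vertex\<close>

text \<open>\<open>x\<close> itself may lie in \<open>V\<close>, and \<open>E\<close> is an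
  arbitrary set of sets that might contain \<open>{x}\<close>; hence the tests
  \<open>c \<noteq> x\<close> and \<open>d \<noteq> x\<close>.\<close>

definition simplicial_in :: "'a set set \<Rightarrow> 'a set \<Rightarrow> 'a \<Rightarrow> bool" where
  "simplicial_in E V x \<longleftrightarrow>
     (\<forall>c\<in>V. \<forall>d\<in>V. c \<noteq> x \<longrightarrow> d \<noteq> x \<longrightarrow> {c, x} \<in> E \<longrightarrow> {d, x} \<in> E \<longrightarrow> c \<noteq> d \<longrightarrow> {c, d} \<in> E)"

text \<open>Dirac's lemma. The head \<open>z\<close> is simplicial, and a simplicial vertex of the
  tail not adjacent to \<open>z\<close> stays simplicial. If the tail is complete, any non-neighbour
  of \<open>z\<close> is a partner for \<open>z\<close>. Otherwise the tail has two nonadjacent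
  simplicial vertices; \<open>z\<close> cannot be adjacent to both, as its later neighbours form a
  clique.\<close>

lemma peo_complete_or_two_simplicial:
  assumes "peo E xs" "distinct xs"
  shows "(\<forall>c\<in>set xs. \<forall>d\<in>set xs. c \<noteq> d \<longrightarrow> {c, d} \<in> E) \<or>
    (\<exists>x\<in>set xs. \<exists>y\<in>set xs. x \<noteq> y \<and> {x, y} \<notin> E \<and>
       simplicial_in E (set xs) x \<and> simplicial_in E (set xs) y)"
  using assms
proof (induction xs)
  case Nil
  then show ?case by simp
next
  case (Cons z xs)
  let ?V = "set (z # xs)"
  have z: "simplicial_in E ?V z" and zx: "z \<notin> set xs"
    using Cons.prems by (auto simp: simplicial_in_def)
  have ext: "simplicial_in E ?V x" if "simplicial_in E (set xs) x" "{z, x} \<notin> E" for x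
    using that by (auto simp: simplicial_in_def)
  have "peo E xs" "distinct xs" using Cons.prems by auto
  from Cons.IH[OF this] consider
    (complete) "\<forall>c\<in>set xs. \<forall>d\<in>set xs. c \<noteq> d \<longrightarrow> {c, d} \<in> E"
  | (two) x y where "x \<in> set xs" "y \<in> set xs" "x \<noteq> y" "{x, y} \<notin> E"
       "simplicial_in E (set xs) x" "simplicial_in E (set xs) y"
    by blast
  then show ?case
  proof cases
    case complete
    show ?thesis
    proof (cases "\<forall>y\<in>set xs. {z, y} \<in> E")
      case True
      then show ?thesis using complete by (auto simp: insert_commute)
    next
      case False
      then obtain y where y: "y \<in> set xs" "{z, y} \<notin> E" by auto
      then have "simplicial_in E ?V y"
        using complete by (intro ext) (auto simp: simplicial_in_def)
      moreover have "z \<noteq> y" using y zx by auto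
      ultimately show ?thesis using y z by auto
    qed
  next
    case two
    have "{z, x} \<notin> E \<or> {z, y} \<notin> E"
    proof (rule ccontr)
      assume "\<not> ?thesis"
      then have "{x, z} \<in> E" "{y, z} \<in> E" by (auto simp: insert_commute)
      then show False using Cons.prems(1) two(1-4) by simp
    qed
    then consider "{z, x} \<notin> E" | "{z, y} \<notin> E" by blast
    then show ?thesis
    proof cases
      case 1
      then have "simplicial_in E ?V x" "z \<noteq> x" using ext two zx by auto
      then show ?thesis using 1 z two(1) by (meson list.set_intros)
    next
      case 2
      then have "simplicial_in E ?V y" "z \<noteq> y" using ext two zx by auto
      then show ?thesis using 2 z two(2) by (meson list.set_intros)
    qed
  qed
qed

text \<open>A simplicial vertex other than \<open>u\<close> can always be moved to the front; the
  rest follows by induction on the length.\<close>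

lemma peo_ending_in:
  assumes "peo E xs" "distinct xs" "u \<in> set xs"
  obtains ys where "peo E (ys @ [u])" "distinct (ys @ [u])" "set (ys @ [u]) = set xs"
  using assms
proof (induction "length xs" arbitrary: xs thesis)
  case 0
  then show ?case by simp
next
  case (Suc n)
  show ?case
  proof (cases "set xs = {u}")
    case True
    then show ?thesis using Suc.prems(1)[of "[]"] by simp
  next
    case False
    then obtain w where w: "w \<in> set xs" "w \<noteq> u" using Suc.prems(4) by auto
    \<comment> \<open>If the vertices form a clique, \<open>w\<close> will do; otherwise one of two
      distinct simplicial vertices differs from \<open>u\<close>.\<close>
    obtain z where z: "z \<in> set xs" "z \<noteq> u" "simplicial_in E (set xs) z"
      using peo_complete_or_two_simplicial[OF Suc.prems(2,3)] w
      by (metis (mono_tags, lifting) simplicial_in_def)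
    let ?xs = "filter (\<lambda>x. x \<noteq> z) xs"
    have "n = length ?xs"
    proof -
      have "length ?xs = card (set xs - {z})"
        using Suc.prems(3) by (simp add: distinct_card[symmetric] set_diff_eq)
      also have "\<dots> = n"
        using Suc.hyps(2) Suc.prems(3) z(1) by (simp add: distinct_card)
      finally show ?thesis by simp
    qed
    then obtain ys where ys: "peo E (ys @ [u])" "distinct (ys @ [u])" "set (ys @ [u]) = set ?xs"
      using Suc.hyps(1)[of ?xs] Suc.prems z by (auto simp: peo_filter)
    show ?thesis
    proof (rule Suc.prems(1)[of "z # ys"])
      show "set ((z # ys) @ [u]) = set xs" using ys(3) z by auto
      show "distinct ((z # ys) @ [u])" using ys(2,3) z(2) by auto
      have "{c, d} \<in> E" if "c \<in> set (ys @ [u])" "d \<in> set (ys @ [u])" "{c, z} \<in> E" "{d, z} \<in> E"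
        "c \<noteq> d" for c d
        using that z(3) unfolding ys(3) simplicial_in_def by auto
      then show "peo E ((z # ys) @ [u])" using ys(1) by auto
    qed
  qed
qed

section \<open>Contracting an edge of a chordal graph\<close>

text \<open>\<open>u\<close> survives and inherits the neighbours of \<open>v\<close>; parallel
  edges merge because edges form a set.\<close>

definition contract_edge :: "'a set set \<Rightarrow> 'a \<Rightarrow> 'a \<Rightarrow> 'a set set" where
  "contract_edge E u v = {e \<in> E. v \<notin> e} \<union> {{u, x} | x. {x, v} \<in> E \<and> x \<noteq> u \<and> x \<noteq> v}"

lemma contract_edge_iff:
  assumes "c \<noteq> v" "d \<noteq> v" "c \<noteq> d"
  shows "{c, d} \<in> contract_edge E u v \<longleftrightarrow>
    {c, d} \<in> E \<or> c = u \<and> {d, v} \<in> E \<or> d = u \<and> {c, v} \<in> E"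
  using assms unfolding contract_edge_def by (auto simp: doubleton_eq_iff)

text \<open>With \<open>u\<close> last, dropping \<open>v\<close> from the list suffices. If an
  entry \<open>z\<close> before \<open>v\<close> becomes adjacent to \<open>u\<close> through
  \<open>v\<close>, its other later neighbours are adjacent to \<open>v\<close>, hence to
  \<open>u\<close> after contraction. At \<open>v\<close> itself, its later neighbours together with
  \<open>u\<close> already form a clique, so the remaining edges do not change.\<close>

lemma peo_contract_edge:
  assumes "peo E (xs @ [u])" "distinct (xs @ [u])" "v \<in> set xs" "{u, v} \<in> E"
  shows "peo (contract_edge E u v) (filter (\<lambda>x. x \<noteq> v) xs @ [u])"
  using assms
proof (induction xs)
  case Nil
  then show ?case by simp
next
  case (Cons z xs)
  let ?E = "contract_edge E u v"
  show ?case
  proof (cases "z = v")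
    case True
    have v: "v \<notin> set xs" "v \<noteq> u" using Cons.prems(2) True by auto
    have cl: "{c, d} \<in> E" if "c \<in> insert u (set xs)" "d \<in> insert u (set xs)"
      "{c, v} \<in> E" "{d, v} \<in> E" "c \<noteq> d" for c d
      using Cons.prems(1) True that by auto
    have "peo ?E (xs @ [u])"
    proof (rule peo_cong)
      show "{c, d} \<in> E \<longleftrightarrow> {c, d} \<in> ?E"
        if "c \<in> set (xs @ [u])" "d \<in> set (xs @ [u])" "c \<noteq> d" for c d
      proof -
        have "c \<noteq> v" "d \<noteq> v" using that v by auto
        then show ?thesis
          using contract_edge_iff[of c v d E u] that cl[of c d] Cons.prems(4) by auto
      qed
    qed (use Cons.prems in auto)
    moreover have "filter (\<lambda>x. x \<noteq> v) xs = xs" using v by (auto simp: filter_id_conv)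
    ultimately show ?thesis using True by simp
  next
    case False
    have vs: "v \<in> set xs" "v \<noteq> u" "z \<noteq> u" "z \<notin> set xs" using Cons.prems False by auto
    have cl: "{c, d} \<in> E" if "c \<in> insert u (set xs)" "d \<in> insert u (set xs)"
      "{c, z} \<in> E" "{d, z} \<in> E" "c \<noteq> d" for c d
      using Cons.prems(1) that by auto
    have "{c, d} \<in> ?E" if cd: "c \<in> insert u (set xs)" "d \<in> insert u (set xs)" "c \<noteq> v" "d \<noteq> v"
      "{c, z} \<in> ?E" "{d, z} \<in> ?E" "c \<noteq> d" for c d
    proof -
      have z: "c \<noteq> z" "d \<noteq> z" using cd vs by auto
      have "{c, z} \<in> E \<or> c = u \<and> {z, v} \<in> E" "{d, z} \<in> E \<or> d = u \<and> {z, v} \<in> E"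
        using cd contract_edge_iff[of _ v z E u] z False vs by auto
      moreover have "{z, v} \<in> E \<longleftrightarrow> {v, z} \<in> E" by (simp add: insert_commute)
      ultimately show ?thesis
        using cl[of c d] cl[of c v] cl[of d v] vs cd contract_edge_iff[of c v d E u] by auto
    qed
    moreover have "peo ?E (filter (\<lambda>x. x \<noteq> v) xs @ [u])"
      using Cons.IH Cons.prems vs by auto
    ultimately show ?thesis using False vs by auto
  qed
qed

lemma finite_simple_graph_contract_edge:
  assumes "finite_simple_graph H" "u \<in> verts H" "u \<noteq> v"
  shows "finite_simple_graph (verts H - {v}, contract_edge (edges H) u v)"
  using assms edge_endpoints[OF assms(1)] unfolding finite_simple_graph_def contract_edge_def
  by (auto simp: card_insert_if)

text \<open>Two edges disappear: \<open>{u, v}\<close> itself, and \<open>{t, v}\<close>, whose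
  image \<open>{u, t}\<close> is already an edge.\<close>

lemma card_contract_edge:
  assumes "finite_simple_graph H" "{u, v} \<in> edges H" "{t, u} \<in> edges H" "{t, v} \<in> edges H"
  shows "card (contract_edge (edges H) u v) + 2 \<le> card (edges H)"
proof -
  let ?N = "nbhd H v"
  have sub: "contract_edge (edges H) u v \<subseteq>
      {e \<in> edges H. v \<notin> e} \<union> (\<lambda>x. {u, x}) ` (?N - {u, t})"
    using assms edge_endpoints[OF assms(1)]
    by (auto simp: contract_edge_def nbhd_def insert_commute)
  have fin: "finite ?N" using finite_nbhd[OF assms(1)] .
  have ut: "u \<noteq> t" "{u, t} \<subseteq> ?N"
    using assms edge_endpoints(3)[OF assms(1,3)] by (auto simp: nbhd_def)
  have "card (contract_edge (edges H) u v) \<le>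
      card ({e \<in> edges H. v \<notin> e} \<union> (\<lambda>x. {u, x}) ` (?N - {u, t}))"
    using sub fin finite_edges[OF assms(1)] by (intro card_mono) auto
  also have "\<dots> \<le> card {e \<in> edges H. v \<notin> e} + card (?N - {u, t})"
    using card_Un_le card_image_le[of "?N - {u, t}" "\<lambda>x. {u, x}"] fin
    by (meson add_left_mono finite_Diff le_trans)
  also have "card (?N - {u, t}) = card ?N - 2"
    using ut fin by (subst card_Diff_subset) auto
  also have "card {e \<in> edges H. v \<notin> e} + (card ?N - 2) + 2 = card (edges H)"
    using card_edges_split[OF assms(1), of v] card_mono[OF fin ut(2)] ut(1) by simp
  finally show ?thesis by simp
qed

text \<open>Stating bridges through cuts \<open>S\<close> avoids reasoning about paths and cycles.\<close>

lemma peo_edge_without_triangle_is_bridge: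
  assumes "peo E xs" "distinct xs" "u \<in> set xs" "v \<in> set xs" "u \<noteq> v" "{u, v} \<in> E"
    and "\<And>t. t \<in> set xs \<Longrightarrow> t \<noteq> u \<Longrightarrow> t \<noteq> v \<Longrightarrow> {t, u} \<in> E \<Longrightarrow> {t, v} \<notin> E"
  shows "\<exists>S\<subseteq>set xs. u \<in> S \<and> v \<notin> S \<and>
    (\<forall>x\<in>S. \<forall>y\<in>set xs - S. {x, y} \<in> E \<longrightarrow> x = u \<and> y = v)"
  using assms
proof (induction xs)
  case Nil
  then show ?case by simp
next
  case (Cons z xs)
  have cl: "{c, d} \<in> E" if "c \<in> set xs" "d \<in> set xs" "{c, z} \<in> E" "{d, z} \<in> E" "c \<noteq> d" for c d
    using Cons.prems(1) that by auto
  have zx: "z \<notin> set xs" using Cons.prems by auto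
  consider "z = u" | "z = v" | "z \<noteq> u" "z \<noteq> v" by auto
  then show ?case
  proof cases
    case 1
    \<comment> \<open>Any other neighbour of \<open>u\<close> would be adjacent to \<open>v\<close>
      and close a triangle, so \<open>{u}\<close> is the desired side.\<close>
    have "y = v" if "y \<in> set xs" "{u, y} \<in> E" for y
      using cl[of y v] Cons.prems(3-7) that 1 zx
      by (metis insert_commute list.set_intros(2) set_ConsD)
    then show ?thesis using 1 Cons.prems(5) by (intro exI[of _ "{u}"]) auto
  next
    case 2
    have "x = u" if "x \<in> set xs" "{x, v} \<in> E" for x
      using cl[of x u] Cons.prems(3-7) that 2 zx
      by (metis insert_commute list.set_intros(2) set_ConsD)
    then show ?thesis using 2 Cons.prems(2-5) by (intro exI[of _ "set xs"]) auto
  next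
    case 3
    obtain S where S: "S \<subseteq> set xs" "u \<in> S" "v \<notin> S"
      "\<And>x y. x \<in> S \<Longrightarrow> y \<in> set xs \<Longrightarrow> y \<notin> S \<Longrightarrow> {x, y} \<in> E \<Longrightarrow> x = u \<and> y = v"
    proof -
      have "\<exists>S\<subseteq>set xs. u \<in> S \<and> v \<notin> S \<and>
        (\<forall>x\<in>S. \<forall>y\<in>set xs - S. {x, y} \<in> E \<longrightarrow> x = u \<and> y = v)"
        by (rule Cons.IH) (use Cons.prems 3 in \<open>simp_all\<close>)
      then show thesis using that by blast
    qed
    \<comment> \<open>If \<open>z\<close> had neighbours on both sides, these would be adjacent,
      hence equal to \<open>u\<close> and \<open>v\<close>, giving a triangle. So \<open>z\<close>
      can join the side where its neighbours lie.\<close>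
    have side: False if "x \<in> S" "y \<in> set xs" "y \<notin> S" "{x, z} \<in> E" "{y, z} \<in> E" for x y
    proof -
      have "{x, y} \<in> E" using cl[of x y] that S(1) by auto
      then have "x = u" "y = v" using S(4) that by auto
      then show False using Cons.prems(7)[of z] 3 that by (simp add: insert_commute)
    qed
    show ?thesis
    proof (cases "\<exists>x\<in>S. {x, z} \<in> E")
      case True
      then have "{z, y} \<notin> E" if "y \<in> set xs" "y \<notin> S" for y
        using side that by (metis insert_commute)
      then show ?thesis using S 3 zx by (intro exI[of _ "insert z S"]) auto
    next
      case False
      then show ?thesis using S 3 zx by (intro exI[of _ S]) auto
    qed
  qed
qed


section \<open>Eliminating a degree-two path\<close>

declare upt_Suc [simp del]

lemma deficiency_two_nbrs:
  assumes "nbhd G v = {u, b}" "u \<noteq> b"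
  shows "deficiency G v = (if {u, b} \<in> edges G then {} else {{u, b}})"
proof -
  have "{b, u} = {u, b}" by auto
  then show ?thesis using assms(2) unfolding deficiency_def assms(1) by auto
qed

text \<open>\<open>cut\<close> says that \<open>uv\<close> is not a bridge. The guard
  \<open>u \<noteq> b\<close> admits a vertex \<open>v\<close> with a single neighbour:
  \<open>uv\<close> is then a bridge, but eliminating \<open>v\<close> adds no edge.\<close>

lemma eliminate_first_optimal:
  assumes G: "finite_simple_graph G" and nb: "nbhd G v = {u, b}"
    and cut: "\<And>S. u \<noteq> b \<Longrightarrow> S \<subseteq> verts G \<Longrightarrow> u \<in> S \<Longrightarrow> v \<notin> S \<Longrightarrow>
      \<exists>x\<in>S. \<exists>y\<in>verts G - S. {x, y} \<in> edges G \<and> \<not> (x = u \<and> y = v)"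
  shows "card (deficiency G v) + min_fill_in (eliminate G v) \<le> min_fill_in G"
proof -
  let ?G = "eliminate G v"
  obtain xs where xs: "list_ordering G xs" "fill_list G xs = min_fill_in G"
    using min_fill_in_list_attained[OF G] .
  obtain H where H: "finite_simple_graph H" "verts H = verts G" "edges G \<subseteq> edges H"
    "peo (edges H) xs" "card (edges H) = card (edges G) + fill_list G xs"
    using fill_list_triangulation[OF G xs(1)] .
  have dxs: "distinct xs" "set xs = verts G" using xs(1) by (auto simp: list_ordering_def)
  have G': "finite_simple_graph ?G" using finite_simple_graph_eliminate[OF G] .
  have E: "{u, v} \<in> edges G" "{b, v} \<in> edges G" using nb by (auto simp: nbhd_def)
  have uv: "u \<in> verts G" "v \<in> verts G" "u \<noteq> v" using edge_endpoints[OF G E(1)] by auto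
  have bv: "b \<in> verts G" "b \<noteq> v" using edge_endpoints[OF G E(2)] by auto
  \<comment> \<open>It suffices to find a triangulation \<open>K\<close> of
    \<open>eliminate G v\<close> that adds fewer edges than \<open>H\<close> adds to
    \<open>G\<close>, by at least the deficiency of \<open>v\<close>.\<close>
  have goal: ?thesis
    if K: "finite_simple_graph K" "verts K = verts G - {v}" "edges ?G \<subseteq> edges K"
      and ys: "peo (edges K) ys" "distinct ys" "set ys = verts G - {v}"
      and c: "card (edges K) + card (edges G) + card (deficiency G v)
        \<le> card (edges H) + card (edges ?G)" for K ys
  proof -
    have o: "list_ordering ?G ys" using ys by (simp add: list_ordering_def)
    have "card (edges ?G) + fill_list ?G ys \<le> card (edges K)"
      using fill_list_le_triangulation[OF G' o K(1) _ K(3) ys(1)] K(2) by simp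
    then show ?thesis
      using min_fill_in_le_fill_list[OF G' o] c H(5) xs(2) by simp
  qed
  show ?thesis
  proof (cases "deficiency G v = {}")
    case True
    let ?K = "(verts G - {v}, {e \<in> edges H. v \<notin> e})" and ?ys = "filter (\<lambda>x. x \<noteq> v) xs"
    show ?thesis
    proof (rule goal)
      show "finite_simple_graph ?K" using H(1,2) by (auto simp: finite_simple_graph_def)
      show "edges ?G \<subseteq> edges ?K" using H(3) True by (auto simp: edges_eliminate[OF G])
      show ys: "distinct ?ys" "set ?ys = verts G - {v}" using dxs by auto
      show "peo (edges ?K) ?ys"
        by (rule peo_cong[OF _ ys(1) peo_filter[OF H(4)]]) auto
      have "card (nbhd G v) \<le> card (nbhd H v)"
        using H(3) by (intro card_mono finite_nbhd[OF H(1)]) (auto simp: nbhd_def)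
      then show "card (edges ?K) + card (edges G) + card (deficiency G v)
        \<le> card (edges H) + card (edges ?G)"
        using card_edges_eliminate[OF G, of v] card_edges_split[OF H(1), of v] by simp
    qed simp
  next
    case False
    then have ub: "u \<noteq> b" "deficiency G v = {{u, b}}"
      unfolding deficiency_def nb by (auto simp: insert_commute)
    have uvH: "{u, v} \<in> edges H" using E(1) H(3) by auto
    \<comment> \<open>Without a triangle, \<open>uv\<close> would be the only edge of
      \<open>H\<close> across some cut \<open>S\<close>, hence also the only one of
      \<open>G\<close>, against \<open>cut\<close>.\<close>
    have "\<exists>t. {t, u} \<in> edges H \<and> {t, v} \<in> edges H"
    proof (rule ccontr)
      assume "\<not> ?thesis"
      then have nt: "{t, v} \<notin> edges H" if "{t, u} \<in> edges H" for t using that by blast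
      obtain S where S: "S \<subseteq> set xs" "u \<in> S" "v \<notin> S"
        "\<forall>x\<in>S. \<forall>y\<in>set xs - S. {x, y} \<in> edges H \<longrightarrow> x = u \<and> y = v"
        using peo_edge_without_triangle_is_bridge[OF H(4) dxs(1) _ _ uv(3) uvH] uv nt dxs(2)
        by blast
      then show False using cut[OF ub(1), of S] H(3) dxs(2) by blast
    qed
    then obtain t where t: "{t, u} \<in> edges H" "{t, v} \<in> edges H" by blast
    obtain ws where ws: "peo (edges H) (ws @ [u])" "distinct (ws @ [u])" "set (ws @ [u]) = set xs"
      using peo_ending_in[OF H(4) dxs(1)] uv(1) dxs(2) by auto
    let ?K = "(verts G - {v}, contract_edge (edges H) u v)"
      and ?ys = "filter (\<lambda>x. x \<noteq> v) ws @ [u]"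
    show ?thesis
    proof (rule goal)
      show "finite_simple_graph ?K"
        using finite_simple_graph_contract_edge[OF H(1), of u v] uv H(2) by simp
      have "{u, b} \<in> contract_edge (edges H) u v"
        using E(2) H(3) ub(1) bv uv by (subst contract_edge_iff) auto
      then show "edges ?G \<subseteq> edges ?K"
        using H(3) ub(2) by (auto simp: edges_eliminate[OF G] contract_edge_def)
      have "v \<in> set ws" using ws(3) uv dxs(2) by auto
      then show "peo (edges ?K) ?ys"
        using peo_contract_edge[OF ws(1,2) _ uvH] by simp
      show "distinct ?ys" using ws(2) by auto
      show "set ?ys = verts G - {v}" using ws(3) uv dxs(2) by auto
      \<comment> \<open>From \<open>G\<close> to \<open>eliminate G v\<close> two edges go and one
        comes, a net loss of one. \<open>H\<close> loses at least two, and the difference pays for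
        the fill edge.\<close>
      have "card (nbhd G v) = 2" using ub(1) nb by simp
      then show "card (edges ?K) + card (edges G) + card (deficiency G v)
        \<le> card (edges H) + card (edges ?G)"
        using card_edges_eliminate[OF G, of v] card_contract_edge[OF H(1) uvH t] ub(2) by simp
    qed simp
  qed
qed

text \<open>Eliminating \<open>a 1\<close> leaves a shorter path of the same kind between the same
  ends, so \<open>eliminate_first_optimal\<close> can be iterated. The last hypothesis says that the
  ends are not separated outside the path; it holds vacuously if they coincide.\<close>

lemma path_first_optimal:
  assumes "finite_simple_graph G" "inj_on a {1..k}" "a ` {1..k} \<subseteq> verts G"
    and "a 0 \<notin> a ` {1..k}" "a (Suc k) \<notin> a ` {1..k}"
    and "\<And>i. i \<in> {1..k} \<Longrightarrow> nbhd G (a i) = {a (i - 1), a (Suc i)}"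
    and "\<And>S. S \<subseteq> verts G - a ` {1..k} \<Longrightarrow> a 0 \<in> S \<Longrightarrow> a (Suc k) \<notin> S \<Longrightarrow>
      \<exists>x\<in>S. \<exists>y\<in>verts G - a ` {1..k} - S. {x, y} \<in> edges G"
  obtains ys where "list_ordering G (map a [1..<Suc k] @ ys)"
    "fill_list G (map a [1..<Suc k] @ ys) = min_fill_in G"
  using assms
proof (induction k arbitrary: G a thesis)
  case 0
  then show ?case using min_fill_in_list_attained[OF "0.prems"(2)] by auto
next
  case (Suc k)
  note G = Suc.prems(2) and inj = Suc.prems(3) and nb = Suc.prems(7)
  define v where "v = a 1"
  \<comment> \<open>The remaining path, reindexed: the end \<open>a 0\<close> keeps index 0 and
    \<open>a 2\<close> becomes \<open>b 1\<close>.\<close>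
  define b where "b i = (if i = 0 then a 0 else a (Suc i))" for i
  let ?G = "eliminate G v"
  let ?P = "a ` {1..Suc k}"
  have nv: "nbhd G v = {a 0, a 2}" using nb[of 1] by (simp add: v_def numeral_2_eq_2)
  have bi: "b i = a (Suc i)" if "i \<ge> 1" for i using that by (auto simp: b_def)
  have b0: "b 0 = a 0" by (simp add: b_def)
  have bP: "b ` {1..k} = a ` {2..Suc k}"
  proof -
    have "b ` {1..k} = (\<lambda>i. a (Suc i)) ` {1..k}" using bi by (intro image_cong) auto
    also have "\<dots> = a ` Suc ` {1..k}" by (simp only: image_image)
    finally show ?thesis by (simp only: image_Suc_atLeastAtMost) (simp add: numeral_2_eq_2)
  qed
  have "{1..Suc k} = insert 1 {2..Suc k}" by auto
  then have P: "?P = insert v (b ` {1..k})" unfolding bP v_def by simp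
  have vb: "v \<notin> b ` {1..k}"
  proof
    assume "v \<in> b ` {1..k}"
    then obtain i where "i \<in> {2..Suc k}" "a 1 = a i" unfolding bP v_def by auto
    then show False using inj_onD[OF inj, of 1 i] by auto
  qed
  have neq: "a i \<noteq> a j" if "i \<in> {1..Suc k}" "j \<le> Suc (Suc k)" "i \<noteq> j" for i j
  proof -
    consider "j = 0" | "j \<in> {1..Suc k}" | "j = Suc (Suc k)"
      using \<open>j \<le> Suc (Suc k)\<close> by force
    moreover have "a i \<in> ?P" using that by blast
    ultimately show ?thesis
      using that inj_onD[OF inj, of i j] Suc.prems(5,6) by cases metis+
  qed
  have vV: "v \<in> verts G" using Suc.prems(4) P by auto
  have E': "edges ?G = {e \<in> edges G. v \<notin> e} \<union> deficiency G v" using edges_eliminate[OF G] .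
  have V': "verts ?G - b ` {1..k} = verts G - ?P" using P by auto
  have G': "finite_simple_graph ?G" using finite_simple_graph_eliminate[OF G] .
  obtain ys where ys: "list_ordering ?G (map b [1..<Suc k] @ ys)"
    "fill_list ?G (map b [1..<Suc k] @ ys) = min_fill_in ?G"
  proof (rule Suc.IH[OF _ G'])
    show "inj_on b {1..k}"
    proof (rule inj_onI)
      fix i j assume "i \<in> {1..k}" "j \<in> {1..k}" "b i = b j"
      then show "i = j" using inj_onD[OF inj, of "Suc i" "Suc j"] bi[of i] bi[of j] by auto
    qed
    show "b ` {1..k} \<subseteq> verts ?G" using Suc.prems(4) P vb by auto
    show "b 0 \<notin> b ` {1..k}" using Suc.prems(5) P b0 by auto
    show "b (Suc k) \<notin> b ` {1..k}" using Suc.prems(6) P bi[of "Suc k"] by auto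
    show "nbhd ?G (b i) = {b (i - 1), b (Suc i)}" if i: "i \<in> {1..k}" for i
    proof -
      have ne: "a (Suc i) \<noteq> v" "a (Suc i) \<noteq> a 0" "a (Suc (Suc i)) \<noteq> v" "a 0 \<noteq> v"
        using neq[of 1 0] neq[of "Suc i" 1] neq[of "Suc i" 0] neq[of 1 "Suc (Suc i)"] i by (auto simp: v_def)
      have na: "nbhd G (a (Suc i)) = {a i, a (Suc (Suc i))}" using nb[of "Suc i"] i by simp
      have nG: "nbhd ?G (a (Suc i)) =
          (nbhd G (a (Suc i)) - {v}) \<union> {u. {u, a (Suc i)} \<in> deficiency G v}"
        using ne(1) by (auto simp: nbhd_def E')
      show ?thesis
      \<comment> \<open>Only \<open>a 2\<close> sees a change: its neighbour \<open>a 1\<close> is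
        replaced by \<open>a 0\<close>. The edge between \<open>a 0\<close> and \<open>a 2\<close>
        can be present beforehand only if \<open>a 0 = a 3\<close>.\<close>
      proof (cases "i = 1")
        case True
        have "{u. {u, a 2} \<in> deficiency G v} = (if {a 0, a 2} \<in> edges G then {} else {a 0})"
          using deficiency_two_nbrs[OF nv] ne True
          by (auto simp: doubleton_eq_iff numeral_2_eq_2)
        moreover have "{a 0, a 2} \<in> edges G \<longleftrightarrow> a 0 \<in> nbhd G (a (Suc i))"
          using True by (simp add: nbhd_def numeral_2_eq_2)
        ultimately show ?thesis
          using True ne na nG b0 bi[of i] bi[of "Suc i"]
          by (auto simp: numeral_2_eq_2 v_def split: if_splits)
      next
        case False
        have "{u. {u, a (Suc i)} \<in> deficiency G v} = {}"
          using ne neq[of "Suc i" 2] i False unfolding deficiency_def nv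
          by (auto simp: doubleton_eq_iff)
        moreover have "a i \<noteq> v" using neq[of i 1] i False by (auto simp: v_def)
        moreover have bi_pred: "b (i - 1) = a i" using i False by (cases i) (auto simp: b_def)
        ultimately show ?thesis
          using na nG bi[of i] bi[of "Suc i"] bi_pred i False ne by auto
      qed
    qed
    show "\<exists>x\<in>S. \<exists>y\<in>verts ?G - b ` {1..k} - S. {x, y} \<in> edges ?G"
      if S: "S \<subseteq> verts ?G - b ` {1..k}" "b 0 \<in> S" "b (Suc k) \<notin> S" for S
    proof -
      obtain x y where xy: "x \<in> S" "y \<in> verts G - ?P - S" "{x, y} \<in> edges G"
        using Suc.prems(8)[of S] S b0 bi[of "Suc k"] unfolding V' by auto
      then have "v \<notin> {x, y}" using S(1) P by auto
      then show ?thesis using xy unfolding V' E' by blast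
    qed
  qed
  have "card (deficiency G v) + min_fill_in ?G \<le> min_fill_in G"
  proof (rule eliminate_first_optimal[OF G nv])
    fix S assume S: "a 0 \<noteq> a 2" "S \<subseteq> verts G" "a 0 \<in> S" "v \<notin> S"
    show "\<exists>x\<in>S. \<exists>y\<in>verts G - S. {x, y} \<in> edges G \<and> \<not> (x = a 0 \<and> y = v)"
    proof (rule ccontr)
      assume "\<not> ?thesis"
      then have no: "x = a 0 \<and> y = v" if "x \<in> S" "y \<in> verts G" "y \<notin> S" "{x, y} \<in> edges G" for x y
        using that by blast
      \<comment> \<open>Suppose only the edge from \<open>a 0\<close> to \<open>v\<close> leaves
        \<open>S\<close>. Walking along the path from \<open>a 1 = v\<close> up to the far end
        \<open>a (Suc (Suc k))\<close>, no step can enter \<open>S\<close>; so \<open>S\<close>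
        would separate the ends outside the path.\<close>
      have out: "a (Suc i) \<notin> S" if "i \<le> Suc k" for i
        using that
      proof (induction i)
        case 0
        then show ?case using S(4) by (simp add: v_def)
      next
        case (Suc i)
        have "a (Suc (Suc i)) \<in> nbhd G (a (Suc i))" using nb[of "Suc i"] Suc.prems by simp
        then have e: "{a (Suc (Suc i)), a (Suc i)} \<in> edges G" by (simp add: nbhd_def)
        show ?case
        proof
          assume "a (Suc (Suc i)) \<in> S"
          then have "a (Suc (Suc i)) = a 0" "a (Suc i) = v"
            using no[OF _ _ _ e] Suc edge_endpoints[OF G e] by auto
          then have "i = 0" using neq[of 1 "Suc i"] Suc.prems by (auto simp: v_def)
          then show False using \<open>a (Suc (Suc i)) = a 0\<close> S(1) by (simp add: numeral_2_eq_2)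
        qed
      qed
      have "x \<notin> S" if "x \<in> ?P" for x
      proof -
        obtain i where "x = a i" "1 \<le> i" "i \<le> Suc k" using \<open>x \<in> ?P\<close> by auto
        then show ?thesis using out[of "i - 1"] by auto
      qed
      then have "S \<subseteq> verts G - ?P" using S(2) by auto
      then obtain x y where "x \<in> S" "y \<in> verts G - ?P - S" "{x, y} \<in> edges G"
        using Suc.prems(8)[of S] S(3) out[of "Suc k"] by auto
      then show False using no[of x y] P by auto
    qed
  qed
  moreover have l: "map a [1..<Suc (Suc k)] = v # map b [1..<Suc k]"
  proof -
    have "map a [1..<Suc (Suc k)] = a 1 # map a (map Suc [1..<Suc k])"
      by (simp add: upt_conv_Cons map_Suc_upt)
    also have "map a (map Suc [1..<Suc k]) = map b [1..<Suc k]" using bi by simp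
    finally show ?thesis by (simp add: v_def)
  qed
  moreover have o: "list_ordering G (map a [1..<Suc (Suc k)] @ ys)"
    unfolding l using ys(1) vV by (auto simp: list_ordering_def)
  ultimately show ?case
    using Suc.prems(1)[of ys] min_fill_in_le_fill_list[OF G o] ys(2) by simp
qed

section \<open>Gluing elimination orderings along a separating path\<close>

text \<open>The later neighbours of an entry of \<open>xs\<close> all lie in
  \<open>xs @ [u]\<close>, so \<open>ys\<close> imposes no new condition on them.\<close>

lemma peo_append_via:
  assumes "peo E (xs @ [u])" "peo E (u # ys)" "\<And>x y. x \<in> set xs \<Longrightarrow> y \<in> set ys \<Longrightarrow> {y, x} \<notin> E"
  shows "peo E (xs @ u # ys)"
  using assms
proof (induction xs)
  case Nil
  then show ?case unfolding append_Nil by blast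
next
  case (Cons x xs)
  have "peo E (xs @ u # ys)"
  proof (rule Cons.IH[OF _ Cons.prems(2)])
    show "peo E (xs @ [u])" using Cons.prems(1) by simp
  qed (use Cons.prems(3) in simp)
  moreover have "{c, d} \<in> E"
    if "c \<in> set (xs @ u # ys)" "d \<in> set (xs @ u # ys)" "{c, x} \<in> E" "{d, x} \<in> E" "c \<noteq> d" for c d
  proof -
    have "c \<notin> set ys" "d \<notin> set ys" using Cons.prems(3)[of x] that by auto
    then have "c \<in> set (xs @ [u])" "d \<in> set (xs @ [u])" using that by auto
    then show ?thesis using Cons.prems(1) that(3-5) unfolding append_Cons peo.simps by blast
  qed
  ultimately show ?case unfolding append_Cons peo.simps by blast
qed

text \<open>Each \<open>a i\<close> has at most one later neighbour, and a single vertex is a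
  clique. The start \<open>j\<close> varies for the induction; the application has
  \<open>j = 0\<close>.\<close>

lemma peo_map_upt_append:
  assumes "peo E ys"
    and "\<And>i d. i \<le> k \<Longrightarrow> d \<in> a ` {Suc i..k} \<union> set ys \<Longrightarrow> {d, a i} \<in> E \<Longrightarrow> d = a (Suc i)"
  shows "peo E (map a [j..<Suc k] @ ys)"
proof (induction "Suc k - j" arbitrary: j)
  case 0
  then show ?case using assms(1) by simp
next
  case (Suc n)
  then have j: "j \<le> k" by simp
  have "set (map a [Suc j..<Suc k] @ ys) = a ` {Suc j..k} \<union> set ys"
    by (auto simp: atLeastLessThanSuc_atLeastAtMost)
  moreover have "peo E (map a [Suc j..<Suc k] @ ys)" using Suc by simp
  moreover have "map a [j..<Suc k] @ ys = a j # (map a [Suc j..<Suc k] @ ys)"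
    using j by (simp add: upt_conv_Cons)
  ultimately show ?case using assms(2)[OF j] by (metis peo.simps(2))
qed

text \<open>The ordering is \<open>U\<close> with \<open>a 0\<close> last, then the path, then the
  rest. It is perfect for a subgraph \<open>F\<close> of an optimal triangulation \<open>H\<close>
  that still contains \<open>G\<close>.\<close>

lemma path_between_optimal:
  assumes G: "finite_simple_graph G" and inj: "inj_on a {1..k}" and PV: "a ` {1..k} \<subseteq> verts G"
    and a0: "a 0 \<in> U" and ak: "a (Suc k) \<notin> U" "a (Suc k) \<notin> a ` {1..k}"
    and nb: "\<And>i. i \<in> {1..k} \<Longrightarrow> nbhd G (a i) = {a (i - 1), a (Suc i)}"
    and U: "U \<subseteq> verts G - a ` {1..k}"
    and sep: "\<And>x y. x \<in> U \<Longrightarrow> y \<in> verts G - a ` {1..k} - U \<Longrightarrow> {x, y} \<notin> edges G"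
  obtains xs ys where "list_ordering G (xs @ map a [1..<Suc k] @ ys)"
    "fill_list G (xs @ map a [1..<Suc k] @ ys) = min_fill_in G"
proof -
  let ?P = "a ` {1..k}"
  let ?W = "verts G - ?P - U"
  obtain zs where zs: "list_ordering G zs" "fill_list G zs = min_fill_in G"
    using min_fill_in_list_attained[OF G] .
  obtain H where H: "finite_simple_graph H" "verts H = verts G" "edges G \<subseteq> edges H"
    "peo (edges H) zs" "card (edges H) = card (edges G) + fill_list G zs"
    using fill_list_triangulation[OF G zs(1)] .
  have dzs: "distinct zs" "set zs = verts G" using zs(1) by (auto simp: list_ordering_def)
  \<comment> \<open>\<open>F\<close> drops from \<open>H\<close> exactly the fill edges that meet
    the path or join \<open>U\<close> to \<open>?W\<close>.\<close>
  define F where "F = {e \<in> edges H. e \<subseteq> U} \<union> {e \<in> edges H. e \<subseteq> ?W} \<union> {e \<in> edges G. e \<inter> ?P \<noteq> {}}"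
  let ?K = "(verts G, F)"
  have FH: "F \<subseteq> edges H" using H(3) by (auto simp: F_def)
  have K: "finite_simple_graph ?K" using FH H(1,2) by (auto simp: finite_simple_graph_def)
  have GF: "edges G \<subseteq> F"
  proof
    fix e assume e: "e \<in> edges G"
    then obtain x y where xy: "e = {x, y}" "x \<in> verts G" "y \<in> verts G" using edge_cases[OF G] by blast
    have "{y, x} = {x, y}" by auto
    then show "e \<in> F" using e xy sep[of x y] sep[of y x] H(3) unfolding F_def by auto
  qed
  let ?zU = "filter (\<lambda>x. x \<in> U) zs"
  have zU: "set ?zU = U" using dzs U by auto
  then have "distinct ?zU" "a 0 \<in> set ?zU" using dzs a0 by auto
  then obtain us where us: "peo (edges H) (us @ [a 0])" "distinct (us @ [a 0])"
    "set (us @ [a 0]) = U"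
    using peo_ending_in[OF peo_filter[OF H(4)]] zU by metis
  define ws where "ws = filter (\<lambda>x. x \<in> ?W) zs"
  have ws: "distinct ws" "set ws = ?W" "peo (edges H) ws"
    using dzs peo_filter[OF H(4)] by (auto simp: ws_def)
  have nF: "d \<in> {a (i - 1), a (Suc i)}" if "{d, a i} \<in> F" "i \<in> {1..k}" for d i
  proof -
    have "a i \<in> ?P" using that by auto
    then have "{d, a i} \<in> edges G" using that U by (auto simp: F_def)
    then show ?thesis using nb[OF that(2)] by (auto simp: nbhd_def)
  qed
  have UW: "{x, y} \<notin> F" "{y, x} \<notin> F" if "x \<in> U" "y \<in> ?W" for x y
    using that U by (auto simp: F_def)
  \<comment> \<open>The list starts with \<open>a 0\<close>, whose only possible neighbour on the
    path or in \<open>?W\<close> is \<open>a 1\<close>.\<close>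
  have peoF: "peo F (map a [0..<Suc k] @ ws)"
  proof (rule peo_map_upt_append)
    show "peo F ws"
      by (rule peo_cong[OF _ ws(1,3)]) (use ws(2) FH in \<open>auto simp: F_def\<close>)
    fix i d assume i: "i \<le> k" "d \<in> a ` {Suc i..k} \<union> set ws" "{d, a i} \<in> F"
    show "d = a (Suc i)"
    proof (cases "i = 0")
      case True
      then have "d \<notin> ?W" using UW[OF a0] i(3) by auto
      then obtain j where j: "d = a j" "j \<in> {1..k}" using i(2) ws(2) True by auto
      then have "{a 0, a j} \<in> F" using i(3) True by (simp add: insert_commute)
      then have "a 0 = a (j - 1) \<or> a 0 = a (Suc j)" using nF j(2) by auto
      moreover have "a 0 \<noteq> a (Suc j)"
        using a0 ak(1) U j(2) by (cases "j = k") (force)+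
      moreover have "a 0 \<noteq> a (j - 1)" if "j \<noteq> 1"
        using a0 U j(2) that by force
      ultimately show ?thesis using j(1) True by auto
    next
      case False
      then have ik: "i \<in> {1..k}" using i(1) by auto
      have "d \<noteq> a (i - 1)"
      proof
        assume d: "d = a (i - 1)"
        show False
        proof (cases "i = 1")
          case True
          then show False using d i(2) a0 U ws(2) by auto
        next
          case False
          then have i1: "i - 1 \<in> {1..k}" using ik by auto
          then have "d \<notin> ?W" using d by auto
          then obtain j where "j \<in> {Suc i..k}" "a (i - 1) = a j" using d i(2) ws(2) by auto
          then show False using inj_onD[OF inj, of "i - 1" j] i1 by auto
        qed
      qed
      then show ?thesis using nF[OF i(3) ik] by auto
    qed
  qed
  have split: "map a [0..<Suc k] = a 0 # map a [1..<Suc k]"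
    by (simp add: upt_conv_Cons)
  have sP: "set (map a [1..<Suc k]) = ?P"
    by (simp add: atLeastLessThanSuc_atLeastAtMost)
  have "peo F (us @ a 0 # (map a [1..<Suc k] @ ws))"
  proof (rule peo_append_via)
    show "peo F (us @ [a 0])"
    proof (rule peo_cong[OF _ us(2,1)])
      fix c d assume "c \<in> set (us @ [a 0])" "d \<in> set (us @ [a 0])"
      then have "c \<in> U" "d \<in> U" using us(3) by auto
      then show "{c, d} \<in> edges H \<longleftrightarrow> {c, d} \<in> F" using FH by (auto simp: F_def)
    qed
    show "peo F (a 0 # map a [1..<Suc k] @ ws)" using peoF split by simp
    fix x y assume x: "x \<in> set us" and y: "y \<in> set (map a [1..<Suc k] @ ws)"
    have xU: "x \<in> U" "x \<noteq> a 0" using x us(2,3) by auto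
    \<comment> \<open>A path vertex has in \<open>F\<close> only its two neighbours from
      \<open>G\<close>, and the only one of these that can lie in \<open>U\<close> is
      \<open>a 0\<close>.\<close>
    show "{y, x} \<notin> F"
    proof (cases "y \<in> ?W")
      case True
      then show ?thesis using UW[OF xU(1)] by simp
    next
      case False
      then obtain j where j: "y = a j" "j \<in> {1..k}"
        using y sP ws(2) by (metis Un_iff imageE set_append)
      show ?thesis
      proof
        assume "{y, x} \<in> F"
        then have "x = a (j - 1) \<or> x = a (Suc j)"
          using nF[of x j] j by (auto simp: insert_commute)
        moreover have "x \<noteq> a i" if "i \<le> Suc k" for i
        proof -
          consider "i = 0" | "i \<in> {1..k}" | "i = Suc k" using \<open>i \<le> Suc k\<close> by force
          then show ?thesis using xU U ak(1) by cases auto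
        qed
        ultimately show False
          using j(2) by (metis Suc_le_mono atLeastAtMost_iff diff_le_self le_SucI le_trans)
      qed
    qed
  qed
  moreover have o: "list_ordering G ((us @ [a 0]) @ map a [1..<Suc k] @ ws)"
  proof -
    have "distinct (map a [1..<Suc k])"
      using inj by (simp add: distinct_map atLeastLessThanSuc_atLeastAtMost)
    moreover have "U \<inter> (?P \<union> ?W) = {}" "?P \<inter> ?W = {}" "U \<union> (?P \<union> ?W) = verts G"
      using U PV by auto
    ultimately show ?thesis
      using us(2) ws(1) unfolding list_ordering_def distinct_append[of "us @ [a 0]"]
        distinct_append[of "map a _"] set_append[of "us @ [a 0]"] set_append[of "map a _"]
        us(3) ws(2) sP by simp
  qed
  ultimately have "card (edges G) + fill_list G ((us @ [a 0]) @ map a [1..<Suc k] @ ws) \<le> card F"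
    using fill_list_le_triangulation[OF G o K] GF by simp
  also have "\<dots> \<le> card (edges H)" using FH finite_edges[OF H(1)] by (rule card_mono[rotated])
  finally show thesis
    using that[OF o] min_fill_in_le_fill_list[OF G o] H(5) zs(2) by simp
qed

theorem theorem9:
  fixes G :: "'a ugraph" and P :: "'a set" and a :: "nat \<Rightarrow> 'a" and k :: nat
  assumes "finite_simple_graph G"
    and "P \<subseteq> verts G"
    and "k \<ge> 1"
    and "inj_on a {1..k}" and "P = a ` {1..k}"
    and "path_graph (induced_subgraph G P)"
    and "\<forall>v\<in>P. degree G v = 2"
    and "nbhd_set G P = {a 0, a (k + 1)}"
    and "\<forall>i\<in>{1..k}. nbhd G (a i) = {a (i - 1), a (i + 1)}"
  shows "\<exists>\<sigma>' x l i.
           bij_betw x {1..l} (verts G - P) \<and> i \<le> l \<and>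
           node_ordering G \<sigma>' \<and>
           (\<forall>j\<in>{1..i}. \<sigma>' j = x j) \<and>
           (\<forall>j\<in>{1..k}. \<sigma>' (i + j) = a j) \<and>
           (\<forall>j\<in>{i + 1..l}. \<sigma>' (k + j) = x j) \<and>
           fill_in G \<sigma>' = min_fill_in G"
proof -
  note G = assms(1) and P = assms(5)
  have ends: "a 0 \<notin> a ` {1..k}" "a (Suc k) \<notin> a ` {1..k}"
    using assms(8) P unfolding nbhd_set_def by auto
  have nb: "nbhd G (a i) = {a (i - 1), a (Suc i)}" if "i \<in> {1..k}" for i
    using assms(9) that by simp
  have PV: "a ` {1..k} \<subseteq> verts G" using assms(2) P by simp
  obtain xs ys where o: "list_ordering G (xs @ map a [1..<Suc k] @ ys)"
    and f: "fill_list G (xs @ map a [1..<Suc k] @ ys) = min_fill_in G"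
  \<comment> \<open>The split asks whether the ends are separated outside \<open>P\<close>. If
    \<open>a 0 = a (Suc k)\<close> no such \<open>U\<close> exists and the path goes first, with
    \<open>xs\<close> empty.\<close>
  proof (cases "\<exists>U. U \<subseteq> verts G - a ` {1..k} \<and> a 0 \<in> U \<and> a (Suc k) \<notin> U \<and>
      (\<forall>x\<in>U. \<forall>y\<in>verts G - a ` {1..k} - U. {x, y} \<notin> edges G)")
    case True
    then obtain U where U: "U \<subseteq> verts G - a ` {1..k}" "a 0 \<in> U" "a (Suc k) \<notin> U"
      "\<And>x y. x \<in> U \<Longrightarrow> y \<in> verts G - a ` {1..k} - U \<Longrightarrow> {x, y} \<notin> edges G" by blast
    show thesis
      by (rule path_between_optimal[OF G assms(4) PV U(2,3) ends(2) nb U(1,4)]) (use that in auto)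
  next
    case False
    have cut: "\<exists>x\<in>S. \<exists>y\<in>verts G - a ` {1..k} - S. {x, y} \<in> edges G"
      if "S \<subseteq> verts G - a ` {1..k}" "a 0 \<in> S" "a (Suc k) \<notin> S" for S
    proof (rule ccontr)
      assume "\<not> ?thesis"
      then have "\<forall>x\<in>S. \<forall>y\<in>verts G - a ` {1..k} - S. {x, y} \<notin> edges G" by simp
      with that False show False by meson
    qed
    obtain ys where "list_ordering G (map a [1..<Suc k] @ ys)"
      "fill_list G (map a [1..<Suc k] @ ys) = min_fill_in G"
      using path_first_optimal[OF G assms(4) PV ends nb cut] by blast
    then show thesis using that[of "[]" ys] by simp
  qed
  let ?L = "xs @ map a [1..<Suc k] @ ys"
  \<comment> \<open>Orderings count from 1 and lists from 0. \<open>?x\<close> enumerates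
    \<open>xs @ ys\<close>, so entries of \<open>ys\<close> sit \<open>k\<close> places later in
    \<open>?s\<close>.\<close>
  let ?s = "\<lambda>j. ?L ! (j - 1)" and ?x = "\<lambda>j. (xs @ ys) ! (j - 1)"
  have sP: "set (map a [1..<Suc k]) = P"
    using P by (simp add: atLeastLessThanSuc_atLeastAtMost)
  have d: "distinct (xs @ ys)" and V: "set (xs @ ys) = verts G - P"
  proof -
    have "distinct xs" "distinct ys" "P \<inter> set ys = {}" "set xs \<inter> (P \<union> set ys) = {}"
      "set xs \<union> (P \<union> set ys) = verts G"
      using o unfolding list_ordering_def distinct_append set_append sP by simp_all
    then show "distinct (xs @ ys)" "set (xs @ ys) = verts G - P" by auto
  qed
  have "bij_betw ?x {1..length (xs @ ys)} (verts G - P)"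
    using bij_betw_nth_pred[OF d] V by simp
  moreover have "\<forall>j\<in>{1..length xs}. ?s j = ?x j" by (auto simp: nth_append)
  moreover have "\<forall>j\<in>{1..k}. ?s (length xs + j) = a j"
    by (auto simp: nth_append)
  moreover have "\<forall>j\<in>{length xs + 1..length (xs @ ys)}. ?s (k + j) = ?x j"
    by (auto simp: nth_append)
  moreover have "length xs \<le> length (xs @ ys)" by simp
  moreover note list_ordering_node_ordering[OF o, unfolded f]
  ultimately show ?thesis by blast
qed

end
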